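(* Let $n\geq 3$ and let $\mathbb{P}=\mathrm{circ}(P_1,P_2,\ldots,P_n)$, where $P_k$ is the $k$th Pell number. Put $$g_n=P_1-2P_n+\sum_{k=2}^{n-1}P_{k-1}\left(\frac{P_n}{P_1-P_{n+1}}\right)^{n-k}.$$ Then the inverse of $\mathbb{P}$ is $\mathbb{P}^{-1}=\mathrm{circ}(p_1,p_2,\ldots,p_n)$, where $$p_1=\frac{1}{g_n}\left(1+\frac{2P_n^{\,n-3}}{(P_1-P_{n+1})^{n-2}}+\sum_{k=1}^{n-3}\frac{P_{n-k}P_n^{\,k-1}}{(P_1-P_{n+1})^{k}}\right),$$ $$p_2=\frac{1}{g_n}\left(-2+\sum_{k=1}^{n-2}\frac{P_{n-k-1}P_n^{\,k-1}}{(P_1-P_{n+1})^{k}}\right),$$ $$p_i=-\frac{P_n^{\,i-3}}{g_n(P_1-P_{n+1})^{i-2}},\qquad i=3,4,\ldots,n.$$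
   Context: The Pell numbers are defined by $P_0=0$, $P_1=1$, and $P_k=2P_{k-1}+P_{k-2}$ for $k\geq 2$. For numbers $c_0,c_1,\ldots,c_{n-1}$, $\mathrm{circ}(c_0,c_1,\ldots,c_{n-1})$ denotes the $n\times n$ circulant matrix whose first row is $(c_0,c_1,\ldots,c_{n-1})$ and in which each subsequent row is the cyclic shift of the previous row one position to the right; i.e. its $(i,j)$ entry is $c_{(j-i)\bmod n}$ for $1\le i,j\le n$. Empty sums are $0$. *)

theory Defs
  imports Complex_Main "Jordan_Normal_Form.Matrix"
begin

fun pell :: "nat \<Rightarrow> nat" where
  "pell 0 = 0"
| "pell (Suc 0) = 1"
| "pell (Suc (Suc k)) = 2 * pell (Suc k) + pell k"

text \<open>Rows and columns are indexed from 0. Only the difference of the two indices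
  enters, so the entry formula is the same as for indices starting at 1; the difference is
  taken in the integers, where reduction modulo a positive number gives a nonnegative
  result.\<close>

definition circ :: "'a list \<Rightarrow> 'a mat" where
  "circ cs = mat (length cs) (length cs)
     (\<lambda>(i, j). cs ! nat ((int j - int i) mod int (length cs)))"

end

theory Submission
  imports Defs "Jordan_Normal_Form.Determinant"
begin

text \<open>Identify circulant matrices with elements of \<open>\<real>[t]/(t\<^sup>n - 1)\<close>, writing \<open>A\<close> for the
  Pell circulant, \<open>B\<close> for the claimed inverse, \<open>d = P\<^sub>1 - P\<^sub>n\<^sub>+\<^sub>1\<close> and \<open>q = P\<^sub>n\<close>. The Pell
  recurrence gives \<open>(1 - 2t - t\<^sup>2) A = d - q t\<close>, and the formulas for the \<open>p\<^sub>i\<close> amount to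
  \<open>(d - q t) B = 1 - 2t - t\<^sup>2\<close>. Hence \<open>(d - q t)(A B - 1) = 0\<close>, and \<open>d - q t\<close> is injective
  because \<open>\<bar>q\<bar> < \<bar>d\<bar>\<close>. With \<open>x = q / d\<close>, the sum in \<open>g\<close> telescopes after multiplication by
  \<open>1 + 2x - x\<^sup>2\<close>, which gives \<open>g (1 + 2x - x\<^sup>2) = 1 - x\<^sup>n\<close> and hence \<open>g \<noteq> 0\<close>.\<close>

section \<open>Periodic coefficient sequences modulo t^n - 1\<close>

text \<open>The shift by one matches 1-based coefficients with exponents of \<open>t\<close>.\<close>

definition wrap :: "nat \<Rightarrow> (nat \<Rightarrow> 'a) \<Rightarrow> int \<Rightarrow> 'a" where
  "wrap n f z = f (Suc (nat (z mod int n)))"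

text \<open>The periodic coefficient sequence of the ring element 1;
  \<open>cyc_delta n (z - a)\<close> is that of t^a.\<close>

definition cyc_delta :: "nat \<Rightarrow> int \<Rightarrow> 'a::zero_neq_one" where
  "cyc_delta n z = (if int n dvd z then 1 else 0)"

lemma wrap_cong: "z mod int n = w mod int n \<Longrightarrow> wrap n f z = wrap n f w"
  by (simp add: wrap_def)

lemma cyc_delta_cong: "z mod int n = w mod int n \<Longrightarrow> cyc_delta n z = cyc_delta n w"
  by (simp add: cyc_delta_def dvd_eq_mod_eq_0)

lemma wrap_of_nat: "r < n \<Longrightarrow> wrap n f (int r) = f (Suc r)"
  by (simp add: wrap_def)

lemma wrap_neg: "0 < r \<Longrightarrow> r \<le> n \<Longrightarrow> wrap n f (- int r) = f (Suc (n - r))"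
  using wrap_cong[of "- int r" n "int (n - r)" f] wrap_of_nat[of "n - r" n f]
  by (simp add: of_nat_diff)

lemma cyc_delta_small: "\<bar>z\<bar> < int n \<Longrightarrow> cyc_delta n z = (if z = 0 then 1 else 0)"
  using zdvd_imp_le[of "int n" "\<bar>z\<bar>"] by (auto simp: cyc_delta_def)

text \<open>Convolution with the ring unit: exactly one k < n is congruent to m, and periodicity of
  \<open>f\<close> replaces that k by m.\<close>

lemma sum_cyc_delta:
  fixes f :: "int \<Rightarrow> 'a::semiring_1"
  assumes "0 < n" and per: "\<And>z w. z mod int n = w mod int n \<Longrightarrow> f z = f w"
  shows "(\<Sum>k<n. f (int k) * cyc_delta n (m - int k)) = f m"
proof -
  have "cyc_delta n (m - int k) = (if k = nat (m mod int n) then 1 else (0::'a))"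
    if "k < n" for k
  proof -
    have "int n dvd m - int k \<longleftrightarrow> m mod int n = int k mod int n"
      by (simp add: mod_eq_dvd_iff)
    also have "\<dots> \<longleftrightarrow> k = nat (m mod int n)"
      using that by auto
    finally show ?thesis by (simp add: cyc_delta_def)
  qed
  then have "(\<Sum>k<n. f (int k) * cyc_delta n (m - int k))
      = (\<Sum>k<n. if k = nat (m mod int n) then f (int k) else 0)"
    by (intro sum.cong) auto
  also have "\<dots> = f (m mod int n)"
    using assms(1) by (simp add: nat_less_iff)
  also have "\<dots> = f m"
    by (rule per) simp
  finally show ?thesis .
qed

section \<open>Injectivity of multiplication by d - q t\<close>

text \<open>Going once round the cycle multiplies \<open>e\<close> by (q/d)^n, which is not 1, yet
  periodicity brings back the same value.\<close>

lemma contracting_periodic_eq_0: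
  fixes e :: "int \<Rightarrow> real"
  assumes "0 < n" and "\<bar>q\<bar> < \<bar>d\<bar>"
    and rec: "\<And>m. d * e m = q * e (m - 1)"
    and per: "\<And>m. e (m + int n) = e m"
  shows "e m = 0"
proof -
  have step: "e m = (q / d) * e (m - 1)" for m
    using rec[of m] assms(2) by (auto simp: field_simps)
  have pow: "e (m + int k) = (q / d) ^ k * e m" for k
  proof (induction k)
    case (Suc k)
    then show ?case
      using step[of "m + int (Suc k)"] by (simp add: algebra_simps)
  qed simp
  have "\<bar>q / d\<bar> < 1"
    using assms(2) by (simp add: abs_divide divide_less_eq)
  then have "\<bar>q / d\<bar> ^ n < 1"
    using assms(1) by (simp add: power_less_one_iff)
  then have "(q / d) ^ n \<noteq> 1"
    by (metis abs_one less_irrefl power_abs)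
  then show ?thesis
    using pow[of n] per[of m] by simp
qed

section \<open>Products of circulants as cyclic convolutions\<close>

lemma circ_map_carrier: "circ (map f [1..<n + 1]) \<in> carrier_mat n n"
  by (simp add: circ_def del: upt_Suc)

lemma circ_map_index:
  assumes "i < n" "j < n"
  shows "circ (map f [1..<n + 1]) $$ (i, j) = wrap n f (int j - int i)"
proof -
  have "nat ((int j - int i) mod int n) < n"
    using assms by (simp add: nat_less_iff)
  then show ?thesis
    using assms by (simp add: circ_def wrap_def del: upt_Suc)
qed

lemma circ_mult_index:
  fixes f h :: "nat \<Rightarrow> 'a::semiring_0"
  assumes "i < n" "j < n"
  shows "(circ (map f [1..<n + 1]) * circ (map h [1..<n + 1])) $$ (i, j)
    = (\<Sum>k<n. wrap n f (int k - int i) * wrap n h (int j - int k))"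
proof -
  have "row (circ (map f [1..<n + 1])) i $ k = wrap n f (int k - int i)"
    "col (circ (map h [1..<n + 1])) j $ k = wrap n h (int j - int k)" if "k < n" for k
    using assms that by (simp_all only: index_row index_col carrier_matD[OF circ_map_carrier] circ_map_index)
  then show ?thesis
    using assms
    by (simp add: carrier_matD[OF circ_map_carrier] scalar_prod_def lessThan_atLeast0
        del: upt_Suc Suc_eq_plus1 One_nat_def)
qed

text \<open>The last two hypotheses are the ring equations for A and B, with the argument m - 1
  standing for multiplication by t.\<close>

lemma circ_mult_eq_one:
  fixes f h :: "nat \<Rightarrow> real"
  assumes n: "0 < n" and less: "\<bar>q\<bar> < \<bar>d\<bar>"
    and f: "\<And>m. wrap n f m - 2 * wrap n f (m - 1) - wrap n f (m - 2)
              = d * cyc_delta n m - q * cyc_delta n (m - 1)"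
    and h: "\<And>m. d * wrap n h m - q * wrap n h (m - 1)
              = cyc_delta n m - 2 * cyc_delta n (m - 1) - cyc_delta n (m - 2)"
  shows "circ (map f [1..<n + 1]) * circ (map h [1..<n + 1]) = 1\<^sub>m n"
proof (rule eq_matI)
  fix i j assume "i < dim_row (1\<^sub>m n :: real mat)" "j < dim_col (1\<^sub>m n :: real mat)"
  then have i: "i < n" and j: "j < n" by simp_all
  \<comment> \<open>Row \<open>i\<close> of the product, with columns extended to all integers so
    that recurrences have no boundary cases; \<open>e\<close> is its deviation from row
    \<open>i\<close> of the identity.\<close>
  define c where "c m = (\<Sum>k<n. wrap n f (int k - int i) * wrap n h (m - int k))" for m
  define e where "e m = c m - cyc_delta n (m - int i)" for m
  have convolve: "(\<Sum>k<n. wrap n f (int k - int i) * cyc_delta n (m - int k))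
      = wrap n f (m - int i)" for m
    by (rule sum_cyc_delta[OF n]) (intro wrap_cong mod_diff_cong refl)
  have rec: "d * c m - q * c (m - 1)
      = d * cyc_delta n (m - int i) - q * cyc_delta n (m - 1 - int i)" for m
  proof -
    have "d * c m - q * c (m - 1) = (\<Sum>k<n. wrap n f (int k - int i) *
        (d * wrap n h (m - int k) - q * wrap n h (m - int k - 1)))"
      by (simp add: c_def sum_distrib_left sum_subtractf algebra_simps)
    \<comment> \<open>The equation for \<open>h\<close> leaves only convolutions with shifted units,
      which collapse to shifts of \<open>f\<close>; then the equation for \<open>f\<close>
      applies.\<close>
    also have "\<dots> = (\<Sum>k<n. wrap n f (int k - int i) * cyc_delta n (m - int k))
        - 2 * (\<Sum>k<n. wrap n f (int k - int i) * cyc_delta n (m - 1 - int k))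
        - (\<Sum>k<n. wrap n f (int k - int i) * cyc_delta n (m - 2 - int k))"
      unfolding h by (simp add: sum_distrib_left sum_subtractf sum.distrib algebra_simps)
    also have "\<dots> = d * cyc_delta n (m - int i) - q * cyc_delta n (m - 1 - int i)"
      unfolding convolve using f[of "m - int i"] by (simp add: algebra_simps)
    finally show ?thesis .
  qed
  have per: "e (m + int n) = e m" for m
  proof -
    have "(m + int n - z) mod int n = (m - z) mod int n" for z
      by (metis add_diff_eq add.commute diff_add_eq mod_add_self2)
    then show ?thesis
      unfolding e_def c_def
      by (intro arg_cong2[where f = "(-)"] sum.cong arg_cong2[where f = "(*)"]
          wrap_cong cyc_delta_cong refl)
  qed
  have "e (int j) = 0"
    by (rule contracting_periodic_eq_0[where e = e, OF n less _ per])
      (use rec in \<open>simp add: e_def algebra_simps\<close>)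
  moreover have "cyc_delta n (int j - int i) = (if i = j then 1 else (0::real))"
    using i j by (subst cyc_delta_small) auto
  ultimately show "(circ (map f [1..<n + 1]) * circ (map h [1..<n + 1])) $$ (i, j) = 1\<^sub>m n $$ (i, j)"
    unfolding circ_mult_index[OF i j] using i j by (simp add: e_def c_def)
qed (simp_all add: circ_def)

section \<open>Recurrences with wraparound\<close>

text \<open>Indices wrap only near the start of the cycle, where positions 0 and -1 are read as n
  and n - 1; hence three boundary equations and one interior rule. The free \<open>u\<close>,
  \<open>v\<close>, \<open>w\<close> let both ring equations be instances.\<close>

lemma wrap_recurrence:
  fixes f :: "nat \<Rightarrow> real"
  assumes n: "3 \<le> n"
    and zero: "a * f 1 + b * f n + c * f (n - 1) = u"
    and one: "a * f 2 + b * f 1 + c * f n = v"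
    and two: "a * f 3 + b * f 2 + c * f 1 = w"
    and step: "\<And>k. 4 \<le> k \<Longrightarrow> k \<le> n \<Longrightarrow> a * f k + b * f (k - 1) + c * f (k - 2) = 0"
  shows "a * wrap n f m + b * wrap n f (m - 1) + c * wrap n f (m - 2)
    = u * cyc_delta n m + v * cyc_delta n (m - 1) + w * cyc_delta n (m - 2)"
proof -
  define r where "r = nat (m mod int n)"
  have r: "int r = m mod int n" "r < n"
    using n by (simp_all add: r_def nat_less_iff)
  have eq: "wrap n f (m - z) = wrap n f (int r - z)"
    "cyc_delta n (m - z) = (cyc_delta n (int r - z) :: real)" for z
    by (rule wrap_cong cyc_delta_cong, simp add: r mod_diff_left_eq)+
  have "a * wrap n f (int r - 0) + b * wrap n f (int r - 1) + c * wrap n f (int r - 2)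
    = u * cyc_delta n (int r - 0) + v * cyc_delta n (int r - 1) + w * cyc_delta n (int r - 2)"
  proof -
    consider "r = 0" | "r = 1" | "r = 2" | "3 \<le> r" by linarith
    then show ?thesis
    proof cases
      case 1
      then show ?thesis
        using n zero wrap_of_nat[of 0 n f] wrap_neg[of 1 n f] wrap_neg[of 2 n f]
        by (simp add: cyc_delta_small Suc_diff_Suc numeral_2_eq_2)
    next
      case 2
      then show ?thesis
        using n one wrap_of_nat[of 0 n f] wrap_of_nat[of 1 n f] wrap_neg[of 1 n f]
        by (simp add: cyc_delta_small numeral_2_eq_2)
    next
      case 3
      then show ?thesis
        using n two wrap_of_nat[of 0 n f] wrap_of_nat[of 1 n f] wrap_of_nat[of 2 n f]
        by (simp add: cyc_delta_small numeral_2_eq_2 numeral_3_eq_3)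
    next
      case 4
      then have "int r - 1 = int (r - 1)" "int r - 2 = int (r - 2)" by simp_all
      moreover have "Suc (r - 1) = Suc r - 1" "Suc (r - 2) = Suc r - 2" using 4 by simp_all
      ultimately show ?thesis
        using 4 r(2) step[of "Suc r"] wrap_of_nat[of r n f] wrap_of_nat[of "r - 1" n f]
          wrap_of_nat[of "r - 2" n f]
        by (simp add: cyc_delta_small)
    qed
  qed
  then show ?thesis
    using eq[of 0] eq[of 1] eq[of 2] by simp
qed

section \<open>Pell polynomials\<close>

text \<open>Descending exponents give a Horner scheme. The sums in \<open>g\<close>,
  \<open>p 1\<close> and \<open>p 2\<close> all reduce to this polynomial at x = q/d.\<close>

definition pell_poly :: "nat \<Rightarrow> 'a::comm_semiring_1 \<Rightarrow> 'a" where
  "pell_poly m x = (\<Sum>j = 1..m. of_nat (pell j) * x ^ (m - j))"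

lemma pell_poly_Suc: "pell_poly (Suc m) x = x * pell_poly m x + of_nat (pell (Suc m))"
proof -
  have "(\<Sum>j = 1..m. of_nat (pell j) * x ^ (Suc m - j)) = x * pell_poly m x"
    unfolding pell_poly_def sum_distrib_left
    by (intro sum.cong) (auto simp: Suc_diff_le mult_ac)
  then show ?thesis by (simp add: pell_poly_def)
qed

text \<open>With y = 1/x, this is the truncated Pell generating function times 1 - 2y - y^2, with
  denominators cleared: the recurrence cancels all but the end terms.\<close>

lemma pell_poly_closed_form:
  fixes x :: "'a::comm_ring_1"
  shows "(1 + 2 * x - x\<^sup>2) * pell_poly m x
    = of_nat (pell m) + x * of_nat (pell (Suc m)) - x ^ Suc m"
proof (induction m)
  case 0
  show ?case by (simp add: pell_poly_def)
next
  case (Suc m)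
  have "(1 + 2 * x - x\<^sup>2) * pell_poly (Suc m) x
      = x * ((1 + 2 * x - x\<^sup>2) * pell_poly m x) + (1 + 2 * x - x\<^sup>2) * of_nat (pell (Suc m))"
    by (simp add: pell_poly_Suc algebra_simps)
  also have "\<dots> = of_nat (pell (Suc m)) + x * of_nat (pell (Suc (Suc m))) - x ^ Suc (Suc m)"
    unfolding Suc.IH by (simp add: algebra_simps power2_eq_square)
  finally show ?case .
qed

lemma pell_pos: "0 < k \<Longrightarrow> 0 < pell k"
  by (induction k rule: pell.induct) auto

lemma pell_rec: "2 \<le> k \<Longrightarrow> pell k = 2 * pell (k - 1) + pell (k - 2)"
  by (cases k rule: pell.cases) auto

section \<open>Inverting the Pell circulant\<close>

theorem theorem5:
  fixes n :: nat and P p :: "nat \<Rightarrow> real" and g :: real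
  assumes n: "n \<ge> 3"
    and P: "\<And>k. P k = real (pell k)"
    and g: "g = P 1 - 2 * P n
              + (\<Sum>k = 2..n - 1. P (k - 1) * (P n / (P 1 - P (n + 1))) ^ (n - k))"
    and p1: "p 1 = 1 / g * (1 + 2 * P n ^ (n - 3) / (P 1 - P (n + 1)) ^ (n - 2)
              + (\<Sum>k = 1..n - 3. P (n - k) * P n ^ (k - 1) / (P 1 - P (n + 1)) ^ k))"
    and p2: "p 2 = 1 / g * (- 2
              + (\<Sum>k = 1..n - 2. P (n - k - 1) * P n ^ (k - 1) / (P 1 - P (n + 1)) ^ k))"
    and p: "\<And>i. 3 \<le> i \<Longrightarrow> i \<le> n \<Longrightarrow>
              p i = - (P n ^ (i - 3) / (g * (P 1 - P (n + 1)) ^ (i - 2)))"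
  shows "inverts_mat (circ (map P [1..<n + 1])) (circ (map p [1..<n + 1]))
       \<and> inverts_mat (circ (map p [1..<n + 1])) (circ (map P [1..<n + 1]))"
proof -
  define q where "q = P n"
  define d where "d = P 1 - P (n + 1)"
  define x where "x = q / d"
  define T where "T = pell_poly (n - 2) x"
  obtain N where N: "n = Suc (Suc (Suc N))"
    using le_Suc_ex[OF n] by (auto simp: numeral_3_eq_3)
  have P_rec: "P k = 2 * P (k - 1) + P (k - 2)" if "2 \<le> k" for k
    using pell_rec[OF that] by (simp add: P)
  have P1: "P 1 = 1" and P2: "P 2 = 2"
    by (simp_all add: P numeral_2_eq_2)
  have d_eq: "d = 1 - 2 * q - P (n - 1)"
    using P_rec[of "n + 1"] n P1 by (simp add: d_def q_def)
  have q_eq: "q = 2 * P (n - 1) + P (n - 2)"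
    using P_rec[of n] n by (simp add: q_def)
  \<comment> \<open>With q = x d as well, the identities below become polynomial identities in x, d
    and the value \<open>T\<close>.\<close>
  have P_q_d: "P (n - 1) = 1 - 2 * q - d" "P (n - 2) = 5 * q - 2 + 2 * d"
    using d_eq q_eq by simp_all
  have pos: "0 < q" "0 < P (n - 1)" "0 < P (n - 2)"
    using n pell_pos by (simp_all add: q_def P)
  have q_ge_1: "1 \<le> q"
    using pell_pos[of n] n by (simp add: q_def P)
  \<comment> \<open>Here d is negative and -d = q + (q - 1) + P (n - 1) > q.\<close>
  have less: "\<bar>q\<bar> < \<bar>d\<bar>"
    using pos q_ge_1 d_eq by simp
  have d0: "d \<noteq> 0" using less by auto
  have xd: "x * d = q" using d0 by (simp add: x_def)
  \<comment> \<open>In the claimed entries each denominator has one more factor d than the numerator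
    has factors q.\<close>
  have xpow: "q ^ k / d ^ Suc k = x ^ k / d" for k
    by (simp add: x_def power_divide)

  have T_closed: "(1 + 2 * x - x\<^sup>2) * T = P (n - 2) + x * P (n - 1) - x ^ (n - 1)"
    using pell_poly_closed_form[of x "n - 2"] by (simp add: T_def N P)
  have T_Suc: "pell_poly (n - 1) x = x * T + P (n - 1)"
    using pell_poly_Suc[of "n - 2" x] by (simp add: T_def N P)
  have g_eq: "g = 1 - 2 * q + x * T"
  proof -
    \<comment> \<open>With j = k - 1 the exponent n - k is one more than n - 2 - j, so one factor x
      splits off.\<close>
    have "(\<Sum>k = 2..n - 1. P (k - 1) * x ^ (n - k))
        = (\<Sum>j = 1..n - 2. P j * x ^ (n - Suc j))"
      by (rule sum.reindex_bij_witness[where i = Suc and j = "\<lambda>k. k - 1"]) auto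
    also have "\<dots> = x * T"
      unfolding T_def pell_poly_def sum_distrib_left
    proof (rule sum.cong[OF refl])
      fix j assume "j \<in> {1..n - 2}"
      then have "n - Suc j = Suc (n - 2 - j)" using n by auto
      then show "P j * x ^ (n - Suc j) = x * (real (pell j) * x ^ (n - 2 - j))"
        by (simp add: P)
    qed
    finally show ?thesis
      unfolding g using P1 by (simp add: x_def q_def d_def)
  qed
  have "g * (1 + 2 * x - x\<^sup>2) = (1 - 2 * q) * (1 + 2 * x - x\<^sup>2) + x * ((1 + 2 * x - x\<^sup>2) * T)"
    unfolding g_eq by (simp add: algebra_simps)
  also have "\<dots> = 1 - x * x ^ (n - 1)"
    unfolding T_closed P_q_d by (simp add: algebra_simps power2_eq_square flip: xd)
  also have "\<dots> = 1 - x ^ n"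
    using n by (simp add: power_eq_if)
  finally have "g * (1 + 2 * x - x\<^sup>2) = 1 - x ^ n" .
  moreover have "x ^ n \<noteq> 1"
  proof -
    have "\<bar>x\<bar> < 1"
      using less by (simp add: x_def abs_divide divide_less_eq)
    then have "\<bar>x\<bar> ^ n < 1"
      using n by (simp add: power_less_one_iff)
    then show ?thesis
      by (metis abs_one less_irrefl power_abs)
  qed
  ultimately have g0: "g \<noteq> 0" by auto

  have p_eq: "p (Suc (Suc (Suc k))) = - (x ^ k / d) / g" if "Suc (Suc (Suc k)) \<le> n" for k
  proof -
    have "p (Suc (Suc (Suc k))) = - (q ^ k / (g * d ^ Suc k))"
      using p[of "Suc (Suc (Suc k))"] that by (simp add: q_def d_def)
    also have "\<dots> = - (q ^ k / d ^ Suc k) / g"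
      by simp
    finally show ?thesis unfolding xpow .
  qed
  have p2_eq: "p 2 = (- 2 + T / d) / g"
  proof -
    have "(\<Sum>k = 1..n - 2. P (n - k - 1) * q ^ (k - 1) / d ^ k)
        = (\<Sum>j = 1..n - 2. P j * x ^ (n - 2 - j) / d)"
    proof (rule sum.reindex_bij_witness[where i = "\<lambda>j. n - 1 - j" and j = "\<lambda>k. n - 1 - k"])
      fix k assume "k \<in> {1..n - 2}"
      then obtain l where l: "k = Suc l" "l < n - 2" by (cases k) auto
      then have "n - 2 - (n - 1 - k) = l" "n - 1 - k = n - k - 1" by simp_all
      then show "P (n - 1 - k) * x ^ (n - 2 - (n - 1 - k)) / d = P (n - k - 1) * q ^ (k - 1) / d ^ k"
        using xpow[of l] l by (simp flip: times_divide_eq_right)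
    qed auto
    also have "\<dots> = T / d"
      by (simp add: T_def pell_poly_def P sum_divide_distrib)
    finally show ?thesis
      unfolding p2 by (simp add: q_def d_def)
  qed
  have p1_eq: "p 1 = (1 + (x * T + P (n - 1) - x ^ (n - 2)) / d) / g"
  proof -
    \<comment> \<open>Reversed, the sum in \<open>p 1\<close> covers only j >= 3. The separate
      summand of \<open>p 1\<close> supplies the term for j = 2; the term x^(n-2) for j = 1 is
      absent, hence subtracted.\<close>
    have "(\<Sum>k = 1..n - 3. P (n - k) * q ^ (k - 1) / d ^ k)
        = (\<Sum>j = 3..n - 1. P j * x ^ (n - 1 - j) / d)"
    proof (rule sum.reindex_bij_witness[where i = "\<lambda>j. n - j" and j = "\<lambda>k. n - k"])
      fix k assume "k \<in> {1..n - 3}"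
      then obtain l where l: "k = Suc l" "l < n - 3" by (cases k) auto
      then have "n - 1 - (n - k) = l" by simp
      then show "P (n - k) * x ^ (n - 1 - (n - k)) / d = P (n - k) * q ^ (k - 1) / d ^ k"
        using xpow[of l] l by (simp flip: times_divide_eq_right)
    qed auto
    also have "\<dots> = (\<Sum>j = 3..n - 1. P j * x ^ (n - 1 - j)) / d"
      by (simp add: sum_divide_distrib)
    finally have tail: "(\<Sum>k = 1..n - 3. P (n - k) * q ^ (k - 1) / d ^ k)
        = (\<Sum>j = 3..n - 1. P j * x ^ (n - 1 - j)) / d" .
    have "pell_poly (n - 1) x = (\<Sum>j = 1..n - 1. P j * x ^ (n - 1 - j))"
      by (simp add: pell_poly_def P)
    also have "\<dots> = x ^ (n - 2) + 2 * x ^ (n - 3) + (\<Sum>j = 3..n - 1. P j * x ^ (n - 1 - j))"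
      using n P1 P2
      by (simp add: sum.atLeast_Suc_atMost numeral_2_eq_2 numeral_3_eq_3)
    finally have "(\<Sum>j = 3..n - 1. P j * x ^ (n - 1 - j))
        = x * T + P (n - 1) - x ^ (n - 2) - 2 * x ^ (n - 3)"
      using T_Suc by simp
    moreover have "2 * q ^ (n - 3) / d ^ (n - 2) = 2 * x ^ (n - 3) / d"
      using xpow[of N] by (simp add: N)
    ultimately show ?thesis
      unfolding p1 q_def[symmetric] d_def[symmetric] tail
      by (simp add: diff_divide_distrib add_divide_distrib)
  qed

  \<comment> \<open>Read cyclically, the Pell recurrence fails only at the first two positions, with
    defects P 1 - P (n + 1) = d and P 2 - 2 P 1 - P n = -q.\<close>
  have P_wrap: "1 * wrap n P m + (- 2) * wrap n P (m - 1) + (- 1) * wrap n P (m - 2)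
      = d * cyc_delta n m + (- q) * cyc_delta n (m - 1) + 0 * cyc_delta n (m - 2)" for m
  proof (rule wrap_recurrence[OF n])
    show "1 * P 1 + - 2 * P n + - 1 * P (n - 1) = d"
      using d_eq P1 by (simp add: q_def)
    show "1 * P 2 + - 2 * P 1 + - 1 * P n = - q"
      using P1 P2 by (simp add: q_def)
    show "1 * P 3 + - 2 * P 2 + - 1 * P 1 = 0"
      using P_rec[of 3] by simp
  qed (use P_rec in simp)
  have cancel: "d * (g * ((a + b / d) / g)) = d * a + b" for a b
    using g0 d0 by (simp add: field_simps)
  have dp1: "d * (g * p 1) = d + (x * T + P (n - 1) - x ^ (n - 2))"
    unfolding p1_eq cancel by simp
  have dp2: "d * (g * p 2) = - 2 * d + T"
    unfolding p2_eq cancel by simp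
  have dp_ge_3: "d * (g * p (Suc (Suc (Suc k)))) = - (x ^ k)" if "Suc (Suc (Suc k)) \<le> n" for k
    unfolding p_eq[OF that] using g0 d0 by simp
  have dp3: "d * (g * p 3) = - 1" and dpn: "d * (g * p n) = - (x ^ N)"
    using dp_ge_3[of 0] dp_ge_3[of N] n by (simp_all add: N numeral_3_eq_3)
  \<comment> \<open>Scaling by g and writing q as x d expresses each equation through the
    denominator-free quantities d g p_i; the summand \<open>0 * c\<close> only fits the shape of
    \<open>wrap_recurrence\<close>.\<close>
  have rec_if: "d * a + - q * b + 0 * c = e" if "d * (g * a) - x * (d * (g * b)) = g * e"
    for a b c e
  proof -
    have "g * (d * a - q * b) = g * e"
      using that by (simp add: algebra_simps flip: xd)
    then show ?thesis using g0 by simp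
  qed
  have p_wrap: "d * wrap n p m + (- q) * wrap n p (m - 1) + 0 * wrap n p (m - 2)
      = 1 * cyc_delta n m + (- 2) * cyc_delta n (m - 1) + (- 1) * cyc_delta n (m - 2)" for m
  proof (rule wrap_recurrence[OF n]; rule rec_if)
    \<comment> \<open>The contribution of \<open>p n\<close> cancels the -x^(n-2) in
      \<open>p 1\<close>, and d + P (n - 1) = 1 - 2 q completes g.\<close>
    show "d * (g * p 1) - x * (d * (g * p n)) = g * 1"
      unfolding dp1 dpn unfolding g_eq using d_eq by (simp add: N)
    \<comment> \<open>Of the four entry equations, this is the one that needs the closed form of
      \<open>T\<close>.\<close>
    have "x ^ (n - 1) = x * x ^ (n - 2)" by (simp add: N)
    then show "d * (g * p 2) - x * (d * (g * p 1)) = g * (- 2)"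
      unfolding dp1 dp2 unfolding g_eq using T_closed unfolding P_q_d
      by (simp add: algebra_simps power2_eq_square flip: xd)
    show "d * (g * p 3) - x * (d * (g * p 2)) = g * (- 1)"
      unfolding dp2 dp3 unfolding g_eq by (simp add: algebra_simps flip: xd)
  next
    fix k assume k: "4 \<le> k" "k \<le> n"
    then obtain l where "k = Suc (Suc (Suc (Suc l)))"
      using le_Suc_ex[OF k(1)] by (auto simp: eval_nat_numeral)
    then show "d * (g * p k) - x * (d * (g * p (k - 1))) = g * 0"
      using dp_ge_3[of "Suc l"] dp_ge_3[of l] k by simp
  qed
  let ?A = "circ (map P [1..<n + 1])" and ?B = "circ (map p [1..<n + 1])"
  have AB: "?A * ?B = 1\<^sub>m n"
    by (rule circ_mult_eq_one[OF _ less]) (use n P_wrap p_wrap in simp_all)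
  then have "?B * ?A = 1\<^sub>m n"
    by (rule mat_mult_left_right_inverse[OF circ_map_carrier circ_map_carrier])
  with AB show ?thesis
    unfolding inverts_mat_def carrier_matD(1)[OF circ_map_carrier] by blast
qed

end
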